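(* For any infinite cardinal $\kappa$, each of the three cardinals $\kappa^+$, $\mathrm{cf}[\kappa]^\omega$ and $\mathrm{cof}(\mathcal M)$ is at most $\mathrm{cof}(\mathcal M_{\kappa^\omega})$, and $$\mathrm{cof}(\mathcal M_{\kappa^\omega}) \leq \mathrm{cof}(\mathcal{NWD}_{\kappa^\omega}) \leq 2^\kappa.$$
   Context: The cardinal $\kappa$ carries the discrete topology, and $\kappa^\omega$ is the space of functions $\omega \to \kappa$ with the product topology. For a topological space $X$, $\mathcal M_X$ is the collection of all meager subsets of $X$ (countable unions of nowhere dense sets), $\mathcal M = \mathcal M_{\mathbb R}$, and $\mathcal{NWD}_X$ is the collection of all nowhere dense subsets of $X$. For an ideal $\mathcal I$, $\mathrm{cof}(\mathcal I) = \min\{|\mathcal J| : \mathcal J \subseteq \mathcal I \text{ and } \forall A \in \mathcal I\ \exists B \in \mathcal J\ (B \supseteq A)\}$. $[\kappa]^\omega$ is the set of all countably infinite subsets of $\kappa$; a family $\mathcal F \subseteq [\kappa]^\omega$ is cofinal if for every $A \in [\kappa]^\omega$ there is $B \in \mathcal F$ with $B \supseteq A$; and $\mathrm{cf}[\kappa]^\omega$ is the minimum cardinality of a cofinal subset of $[\kappa]^\omega$. *)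

theory Defs
  imports "HOL-Analysis.Analysis"
begin

unbundle cardinal_syntax

definition nowhere_dense_in :: "'a topology \<Rightarrow> 'a set \<Rightarrow> bool" where
  "nowhere_dense_in X N \<longleftrightarrow>
     N \<subseteq> topspace X \<and> X interior_of (X closure_of N) = {}"

definition nwd_sets :: "'a topology \<Rightarrow> 'a set set" where
  "nwd_sets X = {N. nowhere_dense_in X N}"

definition meager_in :: "'a topology \<Rightarrow> 'a set \<Rightarrow> bool" where
  "meager_in X A \<longleftrightarrow>
     (\<exists>\<N>. countable \<N> \<and> (\<forall>N\<in>\<N>. nowhere_dense_in X N) \<and> A = \<Union>\<N>)"

definition meager_sets :: "'a topology \<Rightarrow> 'a set set" where
  "meager_sets X = {A. meager_in X A}"

text \<open>
  A cardinal is represented, up to \<open>=o\<close>, by a well-order satisfying \<^const>\<open>Card_order\<close>;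
  its underlying set is the field of the order.
\<close>

definition omega_power_space :: "'k rel \<Rightarrow> (nat \<Rightarrow> 'k) topology" where
  "omega_power_space \<kappa> = product_topology (\<lambda>_. discrete_topology (Field \<kappa>)) UNIV"

definition cofinal_in :: "'a set set \<Rightarrow> 'a set set \<Rightarrow> bool" where
  "cofinal_in I J \<longleftrightarrow> J \<subseteq> I \<and> (\<forall>A\<in>I. \<exists>B\<in>J. A \<subseteq> B)"

text \<open>
  The least cardinality of a cofinal subfamily. The minimum is determined only up to \<open>=o\<close>;
  it exists because \<open>I\<close> is cofinal in itself (see \<open>cof_attained\<close>).
\<close>

definition cof :: "'a set set \<Rightarrow> 'a set rel" where
  "cof I = (SOME r. r \<in> {|J| | J. cofinal_in I J} \<and>
                    (\<forall>r'\<in>{|J| | J. cofinal_in I J}. r \<le>o r'))"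

lemma cof_attained:
  shows "\<exists>J. cofinal_in I J \<and> cof I = |J|"
    and "cofinal_in I J' \<Longrightarrow> cof I \<le>o |J'|"
proof -
  let ?R = "{|J| | J. cofinal_in I J}"
  have "cofinal_in I I" by (auto simp: cofinal_in_def)
  then have "?R \<noteq> {}" by blast
  moreover have "\<forall>r\<in>?R. Card_order r" using card_of_Card_order by blast
  ultimately have "\<exists>r. r \<in> ?R \<and> (\<forall>r'\<in>?R. r \<le>o r')"
    using exists_minim_Card_order[of ?R] by blast
  from someI_ex[OF this] have *: "cof I \<in> ?R \<and> (\<forall>r'\<in>?R. cof I \<le>o r')"
    unfolding cof_def .
  then show "\<exists>J. cofinal_in I J \<and> cof I = |J|" by blast
  show "cofinal_in I J' \<Longrightarrow> cof I \<le>o |J'|" using * by blast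
qed

definition countably_infinite_subsets :: "'k set \<Rightarrow> 'k set set" where
  "countably_infinite_subsets K = {A. A \<subseteq> K \<and> countable A \<and> infinite A}"

definition cf_omega :: "'k rel \<Rightarrow> 'k set rel" where
  "cf_omega \<kappa> = cof (countably_infinite_subsets (Field \<kappa>))"

end

(* Three of the inequalities (all but those with kappa^+ and 2^kappa) come from Tukey maps: a pair of
   maps a : I -> I', b : I' -> I such that a A \<subseteq> B implies A \<subseteq> b B turns a cofinal family in I'
   into one in I.

   Given kappa many meager sets M_i, choose x_i outside M_i with x_i(0) = i; the set of all x_i is
   nowhere dense and contained in no M_i. For cof(M) the real line is made a factor of
   kappa^omega, using kappa * 2 = kappa = kappa * omega coordinatewise on binary digits: A is sent to
   the cylinder over A, and M to its section at a point whose section is meager. *)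

theory Submission
  imports Defs
begin

text \<open>The obstacle in the comparison with the real line is that binary expansion is not a
  homeomorphism. Digits read off by \<open>floor\<close> give every real exactly one digit sequence,
  but the set of reals with a given prefix is a half-open interval, and a sequence that is
  eventually constantly 1 belongs to no real. Nowhere density survives both defects: it can be
  tested on any family of sets with nonempty interior such that every nonempty open set contains a
  member, and such a test looks only at finite prefixes, which are always realised. Points outside a
  meager set come from the Baire category theorem. It supplies the x_i, and also the point at which
  a section is meager, because the points with a section that is dense somewhere are covered by
  countably many nowhere dense sets.\<close>

lemma cof_le_cof:
  assumes "\<And>A. A \<in> I \<Longrightarrow> a A \<in> I'" and "\<And>B. B \<in> I' \<Longrightarrow> b B \<in> I"
    and "\<And>A B. A \<in> I \<Longrightarrow> B \<in> I' \<Longrightarrow> a A \<subseteq> B \<Longrightarrow> A \<subseteq> b B"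
  shows "cof I \<le>o cof I'"
proof -
  obtain J where J: "cofinal_in I' J" "cof I' = |J|"
    using cof_attained(1) by blast
  have "cofinal_in I (b ` J)"
    unfolding cofinal_in_def
  proof (intro conjI ballI)
    show "b ` J \<subseteq> I" using J(1) assms(2) by (auto simp: cofinal_in_def)
    fix A assume A: "A \<in> I"
    then obtain B where B: "B \<in> J" "a A \<subseteq> B"
      using J(1) assms(1) unfolding cofinal_in_def by meson
    moreover have "B \<in> I'" using J(1) B(1) by (auto simp: cofinal_in_def)
    ultimately show "\<exists>B\<in>b ` J. A \<subseteq> B" using assms(3)[OF A] by blast
  qed
  then have "cof I \<le>o |b ` J|" by (rule cof_attained(2))
  then show ?thesis
    using J(2) card_of_image ordLeq_transitive by metis
qed

section \<open>Nowhere dense and meager sets in an arbitrary space\<close>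

text \<open>The members of \<open>P\<close> need not be open, which admits half-open dyadic cells.
  In one direction, the interior of \<open>C\<close> minus the closure of \<open>N\<close> is open
  and nonempty, so it contains a member of \<open>P\<close>; in the other, an open set disjoint from
  \<open>N\<close> is disjoint from its closure.\<close>

lemma nowhere_dense_in_pi_base:
  assumes P: "\<And>C. C \<in> P \<Longrightarrow> X interior_of C \<noteq> {}"
    and base: "\<And>U. openin X U \<Longrightarrow> U \<noteq> {} \<Longrightarrow> \<exists>C\<in>P. C \<subseteq> U"
  shows "nowhere_dense_in X N \<longleftrightarrow>
    N \<subseteq> topspace X \<and> (\<forall>C\<in>P. \<exists>C'\<in>P. C' \<subseteq> C \<and> C' \<inter> N = {})"
proof (intro iffI conjI ballI)
  assume N: "nowhere_dense_in X N"
  then show sub: "N \<subseteq> topspace X" by (simp add: nowhere_dense_in_def)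
  fix C assume C: "C \<in> P"
  let ?U = "X interior_of C - X closure_of N"
  have "openin X ?U" by (simp add: openin_diff)
  moreover have "?U \<noteq> {}"
  proof
    assume "?U = {}"
    then have "X interior_of C \<subseteq> X interior_of (X closure_of N)"
      by (intro interior_of_maximal) auto
    then show False using N P[OF C] by (auto simp: nowhere_dense_in_def)
  qed
  ultimately obtain C' where C': "C' \<in> P" "C' \<subseteq> ?U" using base by meson
  then have "C' \<subseteq> C" using interior_of_subset by fastforce
  moreover have "C' \<inter> N = {}" using C'(2) closure_of_subset[OF sub] by blast
  ultimately show "\<exists>C'\<in>P. C' \<subseteq> C \<and> C' \<inter> N = {}" using C'(1) by blast
next
  assume R: "N \<subseteq> topspace X \<and> (\<forall>C\<in>P. \<exists>C'\<in>P. C' \<subseteq> C \<and> C' \<inter> N = {})"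
  have "X interior_of (X closure_of N) = {}"
  proof (rule ccontr)
    assume "\<not> ?thesis"
    then obtain C where "C \<in> P" and C: "C \<subseteq> X interior_of (X closure_of N)"
      using base[OF openin_interior_of] by blast
    then obtain C' where C': "C' \<in> P" "C' \<subseteq> C" "C' \<inter> N = {}" using R by meson
    let ?V = "X interior_of C'"
    have "?V \<inter> N = {}" using C'(3) interior_of_subset[of X C'] by blast
    then have "?V \<inter> X closure_of N = {}"
      by (simp add: openin_Int_closure_of_eq_empty)
    moreover have "?V \<subseteq> X closure_of N"
      using C C'(2) interior_of_subset[of X C'] interior_of_subset[of X "X closure_of N"] by blast
    ultimately show False using P[OF C'(1)] by blast
  qed
  then show "nowhere_dense_in X N" using R by (simp add: nowhere_dense_in_def)
qed

lemma meager_in_UN: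
  assumes "countable I" and "\<And>i. i \<in> I \<Longrightarrow> nowhere_dense_in X (N i)"
  shows "meager_in X (\<Union>i\<in>I. N i)"
  unfolding meager_in_def using assms by (intro exI[of _ "N ` I"]) auto

lemma nowhere_dense_in_imp_meager_in: "nowhere_dense_in X N \<Longrightarrow> meager_in X N"
  using meager_in_UN[of "{()}" X "\<lambda>_. N"] by simp

lemma meager_in_sequence:
  assumes "meager_in X M"
  obtains N :: "nat \<Rightarrow> 'a set" where "\<forall>i. nowhere_dense_in X (N i)" and "M = (\<Union>i. N i)"
proof -
  obtain \<N> where \<N>: "countable \<N>" "\<forall>N\<in>\<N>. nowhere_dense_in X N" "M = \<Union>\<N>"
    using assms by (auto simp: meager_in_def)
  have empty: "nowhere_dense_in X {}" by (simp add: nowhere_dense_in_def)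
  \<comment> \<open>Inserting the empty set guarantees a nonempty family, whose enumeration by
    \<open>from_nat_into\<close> is then onto; the union is unchanged.\<close>
  let ?N = "from_nat_into (insert {} \<N>)"
  have "range ?N = insert {} \<N>" using \<N>(1) by (simp add: range_from_nat_into)
  then have "\<forall>i. nowhere_dense_in X (?N i)"
    using \<N>(2) empty by (metis insert_iff rangeI)
  moreover have "M = (\<Union>i. ?N i)" using \<open>range ?N = _\<close> \<N>(3) by simp
  ultimately show thesis by (rule that)
qed

section \<open>Cylinders and Baire category in kappa^omega\<close>

text \<open>Only the first \<open>n\<close> values of \<open>x\<close> matter, so a finite sequence
  can be passed as an arbitrary function extending it. If one of these values lies outside
  \<open>Field \<kappa>\<close>, the cylinder is empty.\<close>

definition cylinder :: "'k rel \<Rightarrow> (nat \<Rightarrow> 'k) \<Rightarrow> nat \<Rightarrow> (nat \<Rightarrow> 'k) set" where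
  "cylinder \<kappa> x n = {y. (\<forall>i. y i \<in> Field \<kappa>) \<and> (\<forall>i<n. y i = x i)}"

lemma topspace_omega_power_space:
  "topspace (omega_power_space \<kappa>) = {x. \<forall>i. x i \<in> Field \<kappa>}"
  by (auto simp: omega_power_space_def PiE_def Pi_def)

lemma openin_cylinder: "openin (omega_power_space \<kappa>) (cylinder \<kappa> x n)"
proof -
  let ?U = "\<lambda>i. if i < n then Field \<kappa> \<inter> {x i} else Field \<kappa>"
  have "cylinder \<kappa> x n = PiE UNIV ?U"
    by (auto simp: cylinder_def PiE_def Pi_def split: if_splits)
  moreover have "finite {i. ?U i \<noteq> Field \<kappa>}"
    by (rule finite_subset[of _ "{..<n}"]) auto
  ultimately show ?thesis
    by (simp add: omega_power_space_def openin_PiE_gen)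
qed

lemma openin_omega_power_space_contains_cylinder:
  assumes "openin (omega_power_space \<kappa>) U" and "x \<in> U"
  obtains n where "cylinder \<kappa> x n \<subseteq> U"
proof -
  obtain V where V: "finite {i. V i \<noteq> Field \<kappa>}" "x \<in> PiE UNIV V" "PiE UNIV V \<subseteq> U"
    using assms unfolding omega_power_space_def openin_product_topology_alt by fastforce
  obtain n where n: "\<forall>i\<in>{i. V i \<noteq> Field \<kappa>}. i < n"
    using V(1) finite_nat_set_iff_bounded by blast
  have "cylinder \<kappa> x n \<subseteq> PiE UNIV V"
  proof
    fix y assume "y \<in> cylinder \<kappa> x n"
    then have "y i \<in> V i" for i
      using V(2) n by (cases "i < n") (auto simp: cylinder_def PiE_def Pi_def)
    then show "y \<in> PiE UNIV V" by auto
  qed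
  then have "cylinder \<kappa> x n \<subseteq> U" using V(3) by simp
  then show thesis by (rule that)
qed

lemma nowhere_dense_in_omega_power_space:
  "nowhere_dense_in (omega_power_space \<kappa>) N \<longleftrightarrow>
    N \<subseteq> {x. \<forall>i. x i \<in> Field \<kappa>} \<and>
    (\<forall>x n. (\<forall>i. x i \<in> Field \<kappa>) \<longrightarrow>
      (\<exists>y m. (\<forall>i. y i \<in> Field \<kappa>) \<and> cylinder \<kappa> y m \<subseteq> cylinder \<kappa> x n \<and> cylinder \<kappa> y m \<inter> N = {}))"
proof -
  let ?X = "omega_power_space \<kappa>"
  let ?P = "(\<lambda>(x, n). cylinder \<kappa> x n) ` ({x. \<forall>i. x i \<in> Field \<kappa>} \<times> UNIV)"
  have "nowhere_dense_in ?X N \<longleftrightarrow>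
      N \<subseteq> topspace ?X \<and> (\<forall>C\<in>?P. \<exists>C'\<in>?P. C' \<subseteq> C \<and> C' \<inter> N = {})"
  proof (rule nowhere_dense_in_pi_base)
    fix C assume "C \<in> ?P"
    then obtain x n where "\<forall>i. x i \<in> Field \<kappa>" "C = cylinder \<kappa> x n" by auto
    then show "?X interior_of C \<noteq> {}"
      using interior_of_openin[OF openin_cylinder, of \<kappa> x n] by (auto simp: cylinder_def)
  next
    fix U assume U: "openin ?X U" "U \<noteq> {}"
    then obtain x where x: "x \<in> U" by blast
    then have "x \<in> {x. \<forall>i. x i \<in> Field \<kappa>}"
      using openin_subset[OF U(1)] by (auto simp: topspace_omega_power_space)
    moreover obtain n where "cylinder \<kappa> x n \<subseteq> U"
      using U(1) x by (rule openin_omega_power_space_contains_cylinder)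
    ultimately show "\<exists>C\<in>?P. C \<subseteq> U" by (intro bexI[of _ "cylinder \<kappa> x n"]) auto
  qed
  then show ?thesis
    unfolding topspace_omega_power_space by simp
qed

lemma cylinder_mono: "n \<le> m \<Longrightarrow> cylinder \<kappa> x m \<subseteq> cylinder \<kappa> x n"
  by (auto simp: cylinder_def)

lemma in_cylinder_self: "(\<forall>i. x i \<in> Field \<kappa>) \<Longrightarrow> x \<in> cylinder \<kappa> x n"
  by (simp add: cylinder_def)

lemma nowhere_dense_in_omega_power_spaceI:
  assumes "\<And>x. x \<in> N \<Longrightarrow> \<forall>i. x i \<in> Field \<kappa>"
    and "\<And>x n. \<forall>i. x i \<in> Field \<kappa> \<Longrightarrow> \<exists>y m. (\<forall>i. y i \<in> Field \<kappa>) \<and>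
      cylinder \<kappa> y m \<subseteq> cylinder \<kappa> x n \<and> cylinder \<kappa> y m \<inter> N = {}"
  shows "nowhere_dense_in (omega_power_space \<kappa>) N"
  unfolding nowhere_dense_in_omega_power_space
proof (intro conjI allI impI)
  show "N \<subseteq> {x. \<forall>i. x i \<in> Field \<kappa>}" using assms(1) by blast
qed (rule assms(2))

text \<open>Lengthening a cylinder only shrinks it, so a positive length can always be arranged.
  This is needed wherever coordinate 0 is split off or digits are merged.\<close>

lemma nowhere_dense_in_omega_power_spaceE:
  assumes "nowhere_dense_in (omega_power_space \<kappa>) N" and "\<forall>i. x i \<in> Field \<kappa>"
  obtains y m where "\<forall>i. y i \<in> Field \<kappa>"
    and "cylinder \<kappa> y (Suc m) \<subseteq> cylinder \<kappa> x n" and "cylinder \<kappa> y (Suc m) \<inter> N = {}"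
proof -
  obtain y m where *: "\<forall>i. y i \<in> Field \<kappa>" "cylinder \<kappa> y m \<subseteq> cylinder \<kappa> x n"
      "cylinder \<kappa> y m \<inter> N = {}"
    using conjunct2[OF assms(1)[unfolded nowhere_dense_in_omega_power_space]] assms(2) by meson
  show thesis
    by (rule that[OF *(1)]) (use *(2,3) cylinder_mono[of m "Suc m" \<kappa> y] in auto)
qed

text \<open>A countable product of discrete spaces is completely metrizable, so by Baire the
  closures of countably many nowhere dense sets cannot cover a nonempty open cylinder.\<close>

lemma meager_in_omega_power_space_avoid:
  assumes "meager_in (omega_power_space \<kappa>) M" and "\<forall>i. x i \<in> Field \<kappa>"
  obtains y where "\<forall>i. y i \<in> Field \<kappa>" and "y \<in> cylinder \<kappa> x n" and "y \<notin> M"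
proof -
  let ?X = "omega_power_space \<kappa>"
  obtain N :: "nat \<Rightarrow> _" where N: "\<forall>i. nowhere_dense_in ?X (N i)" and M: "M = (\<Union>i. N i)"
    using assms(1) by (rule meager_in_sequence)
  have "completely_metrizable_space ?X"
    unfolding omega_power_space_def
    unfolding completely_metrizable_space_product_topology
    by (intro disjI2 conjI ballI completely_metrizable_space_discrete_topology) simp
  then have *: "?X interior_of \<Union>(range (\<lambda>i. ?X closure_of N i)) = {}"
  proof (intro Baire_category_alt disjI1)
    fix T assume "T \<in> range (\<lambda>i. ?X closure_of N i)"
    then obtain i where "T = ?X closure_of N i" by blast
    then show "closedin ?X T \<and> ?X interior_of T = {}"
      using N by (simp add: nowhere_dense_in_def)
  qed simp_all
  have "\<not> cylinder \<kappa> x n \<subseteq> (\<Union>i. ?X closure_of N i)"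
  proof
    assume "cylinder \<kappa> x n \<subseteq> (\<Union>i. ?X closure_of N i)"
    then have "cylinder \<kappa> x n \<subseteq> {}"
      unfolding *[symmetric] by (rule interior_of_maximal) (rule openin_cylinder)
    then show False using in_cylinder_self[OF assms(2)] by blast
  qed
  moreover have "N i \<subseteq> ?X closure_of N i" for i
    using N by (simp add: nowhere_dense_in_def closure_of_subset)
  ultimately obtain y where "y \<in> cylinder \<kappa> x n" "y \<notin> M" using M by blast
  then show thesis using that by (auto simp: cylinder_def)
qed

section \<open>The lower bounds kappa^+ and cf[kappa]^omega\<close>

lemma cardSuc_le_cof_meager_sets:
  assumes "Card_order \<kappa>" and inf: "infinite (Field \<kappa>)"
  shows "cardSuc \<kappa> \<le>o cof (meager_sets (omega_power_space \<kappa>))"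
proof -
  let ?X = "omega_power_space \<kappa>"
  obtain J where J: "cofinal_in (meager_sets ?X) J" "cof (meager_sets ?X) = |J|"
    using cof_attained(1) by blast
  have "\<not> |J| \<le>o \<kappa>"
  proof
    assume "|J| \<le>o \<kappa>"
    then have "|J| \<le>o |Field \<kappa>|"
      using assms(1) card_of_Field_ordIso ordIso_symmetric ordLeq_ordIso_trans by blast
    moreover have "J \<noteq> {}"
    proof -
      have "{} \<in> meager_sets ?X"
        by (auto simp: meager_sets_def meager_in_def)
      then show ?thesis using J(1) by (auto simp: cofinal_in_def)
    qed
    ultimately obtain f where f: "f ` Field \<kappa> = J"
      using card_of_ordLeq2[of J "Field \<kappa>"] by auto
    have "\<forall>i\<in>Field \<kappa>. \<exists>y. (\<forall>j. y j \<in> Field \<kappa>) \<and> y 0 = i \<and> y \<notin> f i"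
    proof
      fix i assume i: "i \<in> Field \<kappa>"
      then have "meager_in ?X (f i)"
        using f J(1) by (auto simp: cofinal_in_def meager_sets_def)
      \<comment> \<open>Avoiding \<open>f i\<close> inside the cylinder of length 1 around the
        constant point \<open>i\<close> prescribes coordinate 0.\<close>
      then show "\<exists>y. (\<forall>j. y j \<in> Field \<kappa>) \<and> y 0 = i \<and> y \<notin> f i"
        using i by (auto simp: cylinder_def
            elim!: meager_in_omega_power_space_avoid[of _ _ "\<lambda>_. i" 1])
    qed
    then obtain y where y: "\<And>i. i \<in> Field \<kappa> \<Longrightarrow> (\<forall>j. y i j \<in> Field \<kappa>) \<and> y i 0 = i \<and> y i \<notin> f i"
      by metis
    have "nowhere_dense_in ?X (y ` Field \<kappa>)"
    proof (rule nowhere_dense_in_omega_power_spaceI)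
      fix x :: "nat \<Rightarrow> _" and n assume x: "\<forall>i. x i \<in> Field \<kappa>"
      \<comment> \<open>Once coordinate 0 equals \<open>x 0\<close>, the only point of the set left
        to avoid is \<open>y (x 0)\<close>, and a different value at one later coordinate does so.
        The coordinate is \<open>Suc n\<close> rather than \<open>n\<close> because coordinate 0
        must stay untouched even if \<open>n\<close> is 0.\<close>
      obtain c where c: "c \<in> Field \<kappa>" "c \<noteq> y (x 0) (Suc n)"
        using inf by (metis finite.emptyI finite_insert finite_subset insertI1 subsetI)
      let ?z = "x(Suc n := c)"
      have "\<forall>i. ?z i \<in> Field \<kappa>" using x c by simp
      moreover have "cylinder \<kappa> ?z (Suc (Suc n)) \<subseteq> cylinder \<kappa> x n"
        by (auto simp: cylinder_def)
      moreover have False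
        if w: "w \<in> cylinder \<kappa> ?z (Suc (Suc n))" and i: "i \<in> Field \<kappa>" "w = y i" for w i
      proof -
        have "y i 0 = x 0" "y i (Suc n) = c" using w i(2) by (auto simp: cylinder_def)
        then show False using y[OF i(1)] c(2) by simp
      qed
      ultimately show "\<exists>z m. (\<forall>i. z i \<in> Field \<kappa>) \<and> cylinder \<kappa> z m \<subseteq> cylinder \<kappa> x n \<and>
          cylinder \<kappa> z m \<inter> y ` Field \<kappa> = {}"
        by blast
    qed (use y in auto)
    then have "y ` Field \<kappa> \<in> meager_sets ?X"
      by (simp add: meager_sets_def nowhere_dense_in_imp_meager_in)
    then obtain B where "B \<in> J" "y ` Field \<kappa> \<subseteq> B"
      using J(1) unfolding cofinal_in_def by meson
    then show False using f y by blast
  qed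
  then have "\<kappa> <o |J|"
    using assms(1) card_of_Card_order ordLess_or_ordLeq card_order_on_well_order_on by metis
  then show ?thesis
    unfolding J(2) using assms(1) card_of_Card_order by (intro cardSuc_least) auto
qed

text \<open>The points whose range omits some element of \<open>A\<close> form a meager set, so any point outside
  a meager set containing it has a (countable) range covering \<open>A\<close>.\<close>

lemma cf_omega_le_cof_meager_sets:
  fixes \<kappa> :: "'k rel"
  assumes inf: "infinite (Field \<kappa>)"
  shows "cf_omega \<kappa> \<le>o cof (meager_sets (omega_power_space \<kappa>))"
proof -
  let ?X = "omega_power_space \<kappa>"
  obtain k0 where k0: "k0 \<in> Field \<kappa>" using inf by fastforce
  \<comment> \<open>The range of a point may be finite; adding the fixed set \<open>C\<close> makes
    it a member of the family of countably infinite sets.\<close>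
  obtain C where C: "countable C" "infinite C" "C \<subseteq> Field \<kappa>"
    using infinite_countable_subset'[OF inf] by blast
  have "\<exists>y. (\<forall>i. y i \<in> Field \<kappa>) \<and> y \<notin> M" if "meager_in ?X M" for M
    using k0 meager_in_omega_power_space_avoid[OF that, of "\<lambda>_. k0"] by metis
  then obtain g where g: "\<And>M. meager_in ?X M \<Longrightarrow> (\<forall>i. g M i \<in> Field \<kappa>) \<and> g M \<notin> M"
    by metis
  define N where "N a = {x :: nat \<Rightarrow> 'k. (\<forall>i. x i \<in> Field \<kappa>) \<and> a \<notin> range x}" for a
  have N: "nowhere_dense_in ?X (N a)" if a: "a \<in> Field \<kappa>" for a
  proof (rule nowhere_dense_in_omega_power_spaceI)
    fix x :: "nat \<Rightarrow> _" and n assume x: "\<forall>i. x i \<in> Field \<kappa>"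
    \<comment> \<open>Writing \<open>a\<close> at the first free coordinate puts it into the range
      of every point of the smaller cylinder.\<close>
    have "cylinder \<kappa> (x(n := a)) (Suc n) \<subseteq> cylinder \<kappa> x n"
      by (auto simp: cylinder_def)
    moreover have "cylinder \<kappa> (x(n := a)) (Suc n) \<inter> N a = {}"
      by (auto simp: cylinder_def N_def)
    moreover have "\<forall>i. (x(n := a)) i \<in> Field \<kappa>" using x a by simp
    ultimately show "\<exists>y m. (\<forall>i. y i \<in> Field \<kappa>) \<and> cylinder \<kappa> y m \<subseteq> cylinder \<kappa> x n \<and>
        cylinder \<kappa> y m \<inter> N a = {}"
      by blast
  qed (simp add: N_def)
  show ?thesis
    unfolding cf_omega_def
  proof (rule cof_le_cof[where a = "\<lambda>A. \<Union>a\<in>A. N a" and b = "\<lambda>M. range (g M) \<union> C"])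
    fix A assume "A \<in> countably_infinite_subsets (Field \<kappa>)"
    then show "(\<Union>a\<in>A. N a) \<in> meager_sets ?X"
      using N by (auto simp: countably_infinite_subsets_def meager_sets_def intro!: meager_in_UN)
  next
    fix M assume "M \<in> meager_sets ?X"
    then have "\<forall>i. g M i \<in> Field \<kappa>" using g by (simp add: meager_sets_def)
    then show "range (g M) \<union> C \<in> countably_infinite_subsets (Field \<kappa>)"
      using C by (auto simp: countably_infinite_subsets_def)
  next
    fix A M assume "A \<in> countably_infinite_subsets (Field \<kappa>)" and "M \<in> meager_sets ?X"
      and sub: "(\<Union>a\<in>A. N a) \<subseteq> M"
    then have M: "\<forall>i. g M i \<in> Field \<kappa>" "g M \<notin> M" using g by (simp_all add: meager_sets_def)
    show "A \<subseteq> range (g M) \<union> C"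
    proof
      fix a assume "a \<in> A"
      then have "g M \<notin> N a" using sub M(2) by blast
      then show "a \<in> range (g M) \<union> C" using M(1) by (simp add: N_def)
    qed
  qed
qed

section \<open>From meager sets to nowhere dense sets\<close>

text \<open>Since \<open>\<kappa>\<^sup>\<omega>\<close> contains infinitely many disjoint clopen copies of itself, a sequence of nowhere
  dense sets can be coded into a single one.\<close>

lemma cof_meager_sets_le_cof_nwd_sets:
  assumes inf: "infinite (Field \<kappa>)"
  shows "cof (meager_sets (omega_power_space \<kappa>)) \<le>o cof (nwd_sets (omega_power_space \<kappa>))"
proof -
  let ?X = "omega_power_space \<kappa>"
  obtain e :: "nat \<Rightarrow> 'a" where e: "inj e" "range e \<subseteq> Field \<kappa>"
    using inf infinite_countable_subset by blast
  have eF: "e i \<in> Field \<kappa>" for i using e(2) by auto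
  have ran: "\<forall>i. case_nat c x i \<in> Field \<kappa>" if "c \<in> Field \<kappa>" "\<forall>i. x i \<in> Field \<kappa>" for c x
    using that by (auto split: nat.split)
  have cyl: "case_nat c x \<in> cylinder \<kappa> y (Suc n) \<longleftrightarrow> c = y 0 \<and> x \<in> cylinder \<kappa> (y \<circ> Suc) n"
    if "c \<in> Field \<kappa>" for c x y n
    using that by (auto simp: cylinder_def All_less_Suc2 nat.split_sels split: nat.splits)
  have eq: "case_nat (x 0) (x \<circ> Suc) = x" for x :: "nat \<Rightarrow> 'a"
    by (auto split: nat.split)
  \<comment> \<open>A decomposition is fixed for each \<open>M\<close>, since the Tukey map has to
    be a function of \<open>M\<close>.\<close>
  have "\<exists>S :: nat \<Rightarrow> _. (\<forall>i. nowhere_dense_in ?X (S i)) \<and> M = (\<Union>i. S i)"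
    if "meager_in ?X M" for M
    using meager_in_sequence[OF that] by metis
  then obtain S :: "_ \<Rightarrow> nat \<Rightarrow> _"
    where S: "\<And>M i. meager_in ?X M \<Longrightarrow> nowhere_dense_in ?X (S M i)"
      and S_UN: "\<And>M. meager_in ?X M \<Longrightarrow> M = (\<Union>i. S M i)"
    by metis
  have SF: "\<forall>i. x i \<in> Field \<kappa>" if "meager_in ?X M" "x \<in> S M i" for M i x
    using S[OF that(1)] that(2) by (auto simp: nowhere_dense_in_omega_power_space)
  show ?thesis
  proof (rule cof_le_cof[where a = "\<lambda>M. \<Union>i. case_nat (e i) ` S M i"
        and b = "\<lambda>N. \<Union>i. {x. (\<forall>j. x j \<in> Field \<kappa>) \<and> case_nat (e i) x \<in> N}"])
    fix M assume "M \<in> meager_sets ?X"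
    then have M: "meager_in ?X M" by (simp add: meager_sets_def)
    have "nowhere_dense_in ?X (\<Union>i. case_nat (e i) ` S M i)" (is "nowhere_dense_in _ ?N")
    proof (rule nowhere_dense_in_omega_power_spaceI)
      fix x assume "x \<in> ?N"
      then obtain i v where v: "v \<in> S M i" and x: "x = case_nat (e i) v" by blast
      show "\<forall>i. x i \<in> Field \<kappa>" unfolding x using eF SF[OF M v] by (rule ran)
    next
      fix x :: "nat \<Rightarrow> _" and n assume x: "\<forall>i. x i \<in> Field \<kappa>"
      show "\<exists>y m. (\<forall>i. y i \<in> Field \<kappa>) \<and> cylinder \<kappa> y m \<subseteq> cylinder \<kappa> x n \<and>
          cylinder \<kappa> y m \<inter> ?N = {}"
      \<comment> \<open>Coordinate 0 says which copy a point lies in: copy \<open>i\<close> consists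
        of the points starting with \<open>e i\<close>. In copy \<open>i\<close> only
        \<open>S M i\<close> has to be avoided; outside all copies there is nothing to
        avoid.\<close>
      proof (cases "x 0 \<in> range e")
        case True
        then obtain i where i: "x 0 = e i" by blast
        have "\<forall>i. (x \<circ> Suc) i \<in> Field \<kappa>" using x by simp
        then obtain y m where y: "\<forall>i. y i \<in> Field \<kappa>"
            "cylinder \<kappa> y (Suc m) \<subseteq> cylinder \<kappa> (x \<circ> Suc) n"
            "cylinder \<kappa> y (Suc m) \<inter> S M i = {}"
          by (rule nowhere_dense_in_omega_power_spaceE[OF S[OF M]])
        let ?y = "case_nat (e i) y"
        have ey: "?y \<circ> Suc = y" by auto
        have w: "w = case_nat (e i) (w \<circ> Suc) \<and> w \<circ> Suc \<in> cylinder \<kappa> y (Suc m)"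
          if "w \<in> cylinder \<kappa> ?y (Suc (Suc m))" for w
        proof -
          have "\<forall>i. w i \<in> Field \<kappa>" using that by (simp add: cylinder_def)
          then have "w 0 \<in> Field \<kappa>" by blast
          then show ?thesis
            using that cyl[of "w 0" "w \<circ> Suc" ?y "Suc m"] eq[of w] ey by auto
        qed
        have "cylinder \<kappa> ?y (Suc (Suc m)) \<subseteq> cylinder \<kappa> x (Suc n)"
        proof
          fix w assume "w \<in> cylinder \<kappa> ?y (Suc (Suc m))"
          then have "w = case_nat (e i) (w \<circ> Suc)" "w \<circ> Suc \<in> cylinder \<kappa> (x \<circ> Suc) n"
            using w y(2) by auto
          then show "w \<in> cylinder \<kappa> x (Suc n)"
            using cyl[of "e i" "w \<circ> Suc" x n] e(2) i by auto
        qed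
        then have "cylinder \<kappa> ?y (Suc (Suc m)) \<subseteq> cylinder \<kappa> x n"
          using cylinder_mono[of n "Suc n"] by fastforce
        moreover have "cylinder \<kappa> ?y (Suc (Suc m)) \<inter> ?N = {}"
        proof (rule ccontr)
          assume "\<not> ?thesis"
          then obtain j v where v: "v \<in> S M j" "case_nat (e j) v \<in> cylinder \<kappa> ?y (Suc (Suc m))"
            by blast
          then have "e j = e i" "v \<in> cylinder \<kappa> y (Suc m)"
            using cyl[of "e j" v ?y "Suc m"] e(2) ey by auto
          then show False using v(1) y(3) e(1) by (auto dest: injD)
        qed
        moreover have "\<forall>i. ?y i \<in> Field \<kappa>" using y(1) e(2) by (intro ran) auto
        ultimately show ?thesis by blast
      next
        case False
        then have "e i \<noteq> x 0" for i by (metis rangeI)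
        then have "cylinder \<kappa> x (Suc n) \<inter> ?N = {}"
          using cyl[OF eF] by auto
        moreover have "cylinder \<kappa> x (Suc n) \<subseteq> cylinder \<kappa> x n" by (simp add: cylinder_mono)
        ultimately show ?thesis using x by blast
      qed
    qed
    then show "?N \<in> nwd_sets ?X" by (simp add: nwd_sets_def)
  next
    fix N assume "N \<in> nwd_sets ?X"
    then have N: "nowhere_dense_in ?X N" by (simp add: nwd_sets_def)
    have "nowhere_dense_in ?X {x. (\<forall>j. x j \<in> Field \<kappa>) \<and> case_nat (e i) x \<in> N}"
      (is "nowhere_dense_in _ ?P") for i
    proof (rule nowhere_dense_in_omega_power_spaceI)
      fix x :: "nat \<Rightarrow> _" and n assume x: "\<forall>i. x i \<in> Field \<kappa>"
      let ?x = "case_nat (e i) x"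
      have "\<forall>j. ?x j \<in> Field \<kappa>" using eF x by (rule ran)
      \<comment> \<open>The length \<open>Suc n\<close> fixes coordinate 0, so the smaller cylinder
        stays in copy \<open>i\<close>; dropping that coordinate yields a cylinder inside
        \<open>cylinder \<kappa> x n\<close>.\<close>
      then obtain y m where y: "\<forall>i. y i \<in> Field \<kappa>"
          "cylinder \<kappa> y (Suc m) \<subseteq> cylinder \<kappa> ?x (Suc n)"
          "cylinder \<kappa> y (Suc m) \<inter> N = {}"
        by (rule nowhere_dense_in_omega_power_spaceE[OF N])
      have "y \<in> cylinder \<kappa> ?x (Suc n)" using y(1,2) in_cylinder_self by blast
      then have y0: "y 0 = e i" by (auto simp: cylinder_def)
      have *: "case_nat (e i) w \<in> cylinder \<kappa> y (Suc m)" if "w \<in> cylinder \<kappa> (y \<circ> Suc) m" for w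
        using cyl[OF eF] that y0 by simp
      have "cylinder \<kappa> (y \<circ> Suc) m \<subseteq> cylinder \<kappa> x n"
      proof
        fix w assume "w \<in> cylinder \<kappa> (y \<circ> Suc) m"
        then have "case_nat (e i) w \<in> cylinder \<kappa> ?x (Suc n)" using * y(2) by blast
        moreover have "?x \<circ> Suc = x" by auto
        ultimately show "w \<in> cylinder \<kappa> x n" using cyl[OF eF, of i w ?x n] by simp
      qed
      moreover have "cylinder \<kappa> (y \<circ> Suc) m \<inter> ?P = {}" using * y(3) by blast
      moreover have "\<forall>i. (y \<circ> Suc) i \<in> Field \<kappa>" using y(1) by simp
      ultimately show "\<exists>y m. (\<forall>i. y i \<in> Field \<kappa>) \<and> cylinder \<kappa> y m \<subseteq> cylinder \<kappa> x n \<and>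
          cylinder \<kappa> y m \<inter> ?P = {}"
        by blast
    qed simp
    then show "(\<Union>i. ?P i) \<in> meager_sets ?X"
      unfolding meager_sets_def by (auto intro!: meager_in_UN)
  next
    fix M N assume M: "M \<in> meager_sets ?X" and N: "(\<Union>i. case_nat (e i) ` S M i) \<subseteq> N"
    then have M': "meager_in ?X M" by (simp add: meager_sets_def)
    show "M \<subseteq> (\<Union>i. {x. (\<forall>j. x j \<in> Field \<kappa>) \<and> case_nat (e i) x \<in> N})"
    proof
      fix x assume "x \<in> M"
      then obtain i where "x \<in> S M i" using S_UN[OF M'] by blast
      then show "x \<in> (\<Union>i. {x. (\<forall>j. x j \<in> Field \<kappa>) \<and> case_nat (e i) x \<in> N})"
        using N SF[OF M'] by blast
    qed
  qed
qed

section \<open>The upper bound 2^kappa\<close>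

text \<open>For each fixed length the bound follows by induction from \<open>A \<times> A\<close>
  having the size of \<open>A\<close>; a union over countably many lengths does not exceed
  it.\<close>

lemma card_of_lists_le:
  assumes inf: "infinite A"
  shows "|lists A| \<le>o |A|"
proof -
  let ?L = "\<lambda>n. {xs \<in> lists A. length xs = n}"
  have "|?L n| \<le>o |A|" for n
  proof (induction n)
    case 0
    have "?L 0 = {[]}" by auto
    then show ?case using inf by (metis card_of_singl_ordLeq finite.emptyI)
  next
    case (Suc n)
    have "?L (Suc n) = (\<lambda>(x, xs). x # xs) ` (A \<times> ?L n)"
      by (force simp: length_Suc_conv)
    then have "|?L (Suc n)| \<le>o |A \<times> ?L n|" by (simp only: card_of_image)
    moreover have "|A \<times> ?L n| \<le>o |A|"
      using inf Suc by (intro card_of_Sigma_ordLeq_infinite) (auto intro: card_of_mono1)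
    ultimately show ?case by (rule ordLeq_transitive)
  qed
  moreover have "|UNIV :: nat set| \<le>o |A|"
    using inf by (simp add: infinite_iff_card_of_nat)
  ultimately have "|\<Union>n. ?L n| \<le>o |A|"
    using inf by (intro card_of_UNION_ordLeq_infinite) auto
  moreover have "(\<Union>n. ?L n) = lists A" by auto
  ultimately show ?thesis by simp
qed

text \<open>The closure of a nowhere dense set is nowhere dense, and a closed set is determined by
  the cylinders that miss it. Cylinders are named by finite sequences, of which there are at most
  kappa, so at most 2^kappa closed sets arise.\<close>

lemma cof_nwd_sets_le:
  assumes "Card_order \<kappa>" and inf: "infinite (Field \<kappa>)"
  shows "cof (nwd_sets (omega_power_space \<kappa>)) \<le>o ctwo ^c \<kappa>"
proof -
  let ?X = "omega_power_space \<kappa>"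
  let ?L = "lists (Field \<kappa>)"
  let ?F = "\<lambda>W. topspace ?X - (\<Union>w\<in>W. cylinder \<kappa> (\<lambda>i. w ! i) (length w))"
  \<comment> \<open>Most complements of unions of cylinders are not nowhere dense, hence the
    intersection.\<close>
  let ?J = "?F ` Pow ?L \<inter> nwd_sets ?X"
  have "cofinal_in (nwd_sets ?X) ?J"
    unfolding cofinal_in_def
  proof (intro conjI ballI)
    fix N assume "N \<in> nwd_sets ?X"
    then have N: "nowhere_dense_in ?X N" by (simp add: nwd_sets_def)
    then have sub: "N \<subseteq> topspace ?X" by (simp add: nowhere_dense_in_def)
    let ?C = "?X closure_of N"
    have NC: "N \<subseteq> ?C" using sub by (rule closure_of_subset)
    have CN: "nowhere_dense_in ?X ?C"
      using N closure_of_subset_topspace[of ?X N] by (simp add: nowhere_dense_in_def)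
    define W where "W = {w \<in> ?L. cylinder \<kappa> (\<lambda>i. w ! i) (length w) \<inter> ?C = {}}"
    have "x \<in> (\<Union>w\<in>W. cylinder \<kappa> (\<lambda>i. w ! i) (length w))" if x: "x \<in> topspace ?X - ?C" for x
    proof -
      have "openin ?X (topspace ?X - ?C)" by (simp add: openin_diff)
      then obtain n where n: "cylinder \<kappa> x n \<subseteq> topspace ?X - ?C"
        using x by (rule openin_omega_power_space_contains_cylinder)
      have xF: "\<forall>i. x i \<in> Field \<kappa>" using x by (simp add: topspace_omega_power_space)
      let ?w = "map x [0..<n]"
      have "cylinder \<kappa> (\<lambda>i. ?w ! i) (length ?w) = cylinder \<kappa> x n"
        by (auto simp: cylinder_def)
      moreover have "?w \<in> W"
        unfolding W_def mem_Collect_eq calculation using n xF by auto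
      ultimately show ?thesis using in_cylinder_self[OF xF] by blast
    qed
    moreover have "?C \<subseteq> topspace ?X" by (rule closure_of_subset_topspace)
    ultimately have "?C = ?F W" unfolding W_def by blast
    moreover have "W \<in> Pow ?L" by (auto simp: W_def)
    ultimately have "?C \<in> ?J" using CN by (auto simp: nwd_sets_def)
    then show "\<exists>B\<in>?J. N \<subseteq> B" using NC by blast
  qed blast
  then have "cof (nwd_sets ?X) \<le>o |?J|" by (rule cof_attained(2))
  also have "|?J| \<le>o |?F ` Pow ?L|" by (rule card_of_mono1) blast
  also have "|?F ` Pow ?L| \<le>o |Pow ?L|" by (rule card_of_image)
  also have "|Pow ?L| \<le>o |Pow (Field \<kappa>)|"
    using card_of_lists_le[OF inf] unfolding card_of_ordLeq[symmetric]
    by (meson image_Pow_mono inj_on_image_Pow)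
  also have "|Pow (Field \<kappa>)| \<le>o ctwo ^c |Field \<kappa>|"
    unfolding cexp_def ctwo_def by (simp add: Field_card_of card_of_Pow_Func ordIso_imp_ordLeq)
  also have "ctwo ^c |Field \<kappa>| \<le>o ctwo ^c \<kappa>"
    using assms(1)
    by (intro ordIso_imp_ordLeq cexp_cong2) (auto simp: card_of_Field_ordIso Card_order_ctwo card_of_Card_order)
  finally show ?thesis .
qed

section \<open>Binary digits and dyadic cells of the real line\<close>

text \<open>This is the half-open interval from k/2^n to (k+1)/2^n; for fixed \<open>n\<close> these
  intervals partition the line.\<close>

definition dyadic_cell :: "int \<Rightarrow> nat \<Rightarrow> real set" where
  "dyadic_cell k n = {r. \<lfloor>2 ^ n * r\<rfloor> = k}"

text \<open>Digit 0 is the whole integer part, so that all of the line is coded and not just the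
  unit interval; the later digits are bits.\<close>

definition binary_digit :: "nat \<Rightarrow> real \<Rightarrow> int" where
  "binary_digit n r = (if n = 0 then \<lfloor>r\<rfloor> else \<lfloor>2 ^ n * r\<rfloor> mod 2)"

definition digits :: "nat \<Rightarrow> int set" where
  "digits n = (if n = 0 then UNIV else {0, 1})"

lemma binary_digit_in_digits: "binary_digit n r \<in> digits n"
  by (auto simp: binary_digit_def digits_def)

lemma floor_power_Suc_div_2: "\<lfloor>2 ^ Suc n * r\<rfloor> div 2 = \<lfloor>2 ^ n * (r :: real)\<rfloor>"
  using floor_divide_real_eq_div[of 2 "2 ^ Suc n * r"] by simp

text \<open>Each floor is twice the one of the previous level plus the new digit, so digits 0 to
  \<open>n\<close> and the level-\<open>n\<close> cell determine each other.\<close>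

lemma binary_digits_eq_iff:
  "(\<forall>i\<le>n. binary_digit i r = binary_digit i s) \<longleftrightarrow> \<lfloor>2 ^ n * r\<rfloor> = \<lfloor>2 ^ n * s\<rfloor>"
proof (induction n)
  case 0
  show ?case by (simp add: binary_digit_def)
next
  case (Suc n)
  have *: "\<lfloor>2 ^ Suc n * t\<rfloor> = 2 * \<lfloor>2 ^ n * t\<rfloor> + binary_digit (Suc n) t" for t
    using floor_power_Suc_div_2[of n t] mult_div_mod_eq[of 2 "\<lfloor>2 ^ Suc n * t\<rfloor>"]
    by (simp add: binary_digit_def del: power_Suc)
  have "\<lfloor>2 ^ n * r\<rfloor> = \<lfloor>2 ^ n * s\<rfloor>" if "\<lfloor>2 ^ Suc n * r\<rfloor> = \<lfloor>2 ^ Suc n * s\<rfloor>"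
    using that floor_power_Suc_div_2 by metis
  then show ?case
    using Suc *[of r] *[of s] by (auto simp: le_Suc_eq simp del: power_Suc)
qed

lemma exists_binary_digits:
  assumes "\<And>i. i \<le> n \<Longrightarrow> d i \<in> digits i"
  shows "\<exists>r. \<forall>i\<le>n. binary_digit i r = d i"
  using assms
proof (induction n)
  case 0
  show ?case by (rule exI[of _ "of_int (d 0)"]) (simp add: binary_digit_def)
next
  case (Suc n)
  then obtain r where r: "\<forall>i\<le>n. binary_digit i r = d i" by auto
  \<comment> \<open>The new digit is appended to the integer that names the level-\<open>n\<close>
    cell; the witness is the left endpoint of the resulting cell.\<close>
  let ?m = "2 * \<lfloor>2 ^ n * r\<rfloor> + d (Suc n)"
  let ?s = "of_int ?m / 2 ^ Suc n :: real"
  have d: "d (Suc n) \<in> {0, 1}" using Suc.prems[of "Suc n"] by (simp add: digits_def)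
  have m: "\<lfloor>2 ^ Suc n * ?s\<rfloor> = ?m"
    using floor_of_int[of ?m] by (simp del: floor_of_int)
  then have "\<lfloor>2 ^ n * ?s\<rfloor> = ?m div 2" using floor_power_Suc_div_2 by metis
  also have "\<dots> = \<lfloor>2 ^ n * r\<rfloor>" using d by auto
  finally have "\<forall>i\<le>n. binary_digit i ?s = d i" using r binary_digits_eq_iff by metis
  moreover have "binary_digit (Suc n) ?s = d (Suc n)"
    unfolding binary_digit_def m using d by auto
  ultimately show ?case by (metis le_Suc_eq)
qed

lemma dyadic_cell_nonempty: "dyadic_cell k n \<noteq> {}"
proof -
  have "of_int k / 2 ^ n \<in> dyadic_cell k n" by (simp add: dyadic_cell_def)
  then show ?thesis by blast
qed

text \<open>Used to bring the real factor of a box down to a prescribed depth, since a merged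
  cylinder has the same depth in both factors.\<close>

lemma dyadic_cell_refine:
  obtains k' n' where "m \<le> n'" and "dyadic_cell k' n' \<subseteq> dyadic_cell k n"
proof -
  obtain r :: real where r: "\<lfloor>2 ^ n * r\<rfloor> = k"
    using dyadic_cell_nonempty[of k n] by (auto simp: dyadic_cell_def)
  have "dyadic_cell \<lfloor>2 ^ (m + n) * r\<rfloor> (m + n) \<subseteq> dyadic_cell k n"
    unfolding dyadic_cell_def r[symmetric] binary_digits_eq_iff[symmetric] by auto
  then show thesis using that[of "m + n"] by simp
qed

text \<open>A cell contains the open interval between its endpoints, and the cell of
  \<open>r\<close> at a level with 1/2^n below the radius lies in the ball around
  \<open>r\<close>.\<close>

lemma nowhere_dense_in_euclideanreal:
  "nowhere_dense_in (euclidean :: real topology) N \<longleftrightarrow>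
    (\<forall>k n. \<exists>k' n'. dyadic_cell k' n' \<subseteq> dyadic_cell k n \<and> dyadic_cell k' n' \<inter> N = {})"
proof -
  let ?P = "(\<lambda>(k, n). dyadic_cell k n) ` UNIV"
  have "nowhere_dense_in (euclidean :: real topology) N \<longleftrightarrow>
      N \<subseteq> topspace euclidean \<and> (\<forall>C\<in>?P. \<exists>C'\<in>?P. C' \<subseteq> C \<and> C' \<inter> N = {})"
  proof (rule nowhere_dense_in_pi_base)
    fix C assume "C \<in> ?P"
    then obtain k n where C: "C = dyadic_cell k n" by auto
    let ?I = "{of_int k / 2 ^ n <..< (of_int k + 1) / 2 ^ n :: real}"
    have "?I \<subseteq> C"
      unfolding C dyadic_cell_def by (auto simp: floor_eq_iff field_simps)
    then have "?I \<subseteq> euclidean interior_of C"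
      by (intro interior_of_maximal) auto
    moreover have "?I \<noteq> {}" by (simp add: field_simps not_le)
    ultimately show "euclidean interior_of C \<noteq> {}" by blast
  next
    fix U :: "real set" assume "openin euclidean U" "U \<noteq> {}"
    then obtain r e where e: "e > 0" "ball r e \<subseteq> U"
      by (metis open_contains_ball open_openin ex_in_conv)
    obtain n where n: "(1 / 2) ^ n < e" using real_arch_pow_inv[OF e(1), of "1 / 2"] by auto
    have "dyadic_cell \<lfloor>2 ^ n * r\<rfloor> n \<subseteq> ball r e"
    proof
      fix s assume "s \<in> dyadic_cell \<lfloor>2 ^ n * r\<rfloor> n"
      then have "\<bar>2 ^ n * r - 2 ^ n * s\<bar> < 1"
        unfolding dyadic_cell_def by (simp, linarith)
      then have "2 ^ n * \<bar>r - s\<bar> < 1"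
        by (simp add: right_diff_distrib[symmetric] abs_mult)
      then have "\<bar>r - s\<bar> < (1 / 2) ^ n" by (simp add: field_simps power_one_over)
      then show "s \<in> ball r e" using n by (simp add: dist_real_def)
    qed
    then show "\<exists>C\<in>?P. C \<subseteq> U" using e(2) by auto
  qed
  then show ?thesis by simp
qed

section \<open>The real line as a factor of kappa^omega\<close>

text \<open>A coding identifies \<open>\<kappa>\<close> with \<open>\<kappa> \<times> digits n\<close> in each coordinate \<open>n\<close>; merging the digits of
  a real into a point of \<open>\<kappa>\<^sup>\<omega>\<close> then presents \<open>\<kappa>\<^sup>\<omega>\<close> as a product of \<open>\<real>\<close> and \<open>\<kappa>\<^sup>\<omega>\<close>, up to the failure
  of dyadic cells to be open.\<close>

definition digit_coding :: "'k rel \<Rightarrow> (nat \<Rightarrow> 'k \<times> int \<Rightarrow> 'k) \<Rightarrow> bool" where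
  "digit_coding \<kappa> G \<longleftrightarrow> (\<forall>n. bij_betw (G n) (Field \<kappa> \<times> digits n) (Field \<kappa>))"

definition merge_digits :: "(nat \<Rightarrow> 'k \<times> int \<Rightarrow> 'k) \<Rightarrow> real \<Rightarrow> (nat \<Rightarrow> 'k) \<Rightarrow> nat \<Rightarrow> 'k" where
  "merge_digits G r z n = G n (z n, binary_digit n r)"

lemma exists_digit_coding:
  fixes \<kappa> :: "'k rel"
  assumes inf: "infinite (Field \<kappa>)"
  obtains G where "digit_coding \<kappa> G"
proof -
  have "\<exists>g. bij_betw g (Field \<kappa> \<times> digits n) (Field \<kappa>)" for n
  proof -
    have "|digits n| \<le>o |UNIV :: nat set|"
      unfolding card_of_ordLeq[symmetric]
      using countableI_type[of "digits n"] by (auto simp: countable_def)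
    also have "|UNIV :: nat set| \<le>o |Field \<kappa>|"
      using inf by (simp add: infinite_iff_card_of_nat)
    finally show ?thesis
      unfolding card_of_ordIso
      using inf by (intro card_of_Times_infinite_simps) (auto simp: digits_def)
  qed
  then show thesis using that unfolding digit_coding_def by metis
qed

lemma merge_digits_in_Field:
  assumes "digit_coding \<kappa> G" and "\<forall>i. z i \<in> Field \<kappa>"
  shows "\<forall>i. merge_digits G r z i \<in> Field \<kappa>"
proof
  fix i
  have "bij_betw (G i) (Field \<kappa> \<times> digits i) (Field \<kappa>)"
    using assms(1) by (simp add: digit_coding_def)
  then show "merge_digits G r z i \<in> Field \<kappa>"
    using assms(2) binary_digit_in_digits by (auto simp: merge_digits_def bij_betw_def)
qed

text \<open>Injectivity of each \<open>G i\<close> separates the two factors, so a cylinder of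
  length \<open>Suc n\<close> is a box. Its real side has level \<open>n\<close> because coordinates
  0 to \<open>n\<close> carry digits 0 to \<open>n\<close>.\<close>

lemma merge_digits_in_cylinder_iff:
  assumes G: "digit_coding \<kappa> G" and u: "\<forall>i. u i \<in> Field \<kappa>" and z: "\<forall>i. z i \<in> Field \<kappa>"
  shows "merge_digits G r z \<in> cylinder \<kappa> (merge_digits G s u) (Suc n) \<longleftrightarrow>
    z \<in> cylinder \<kappa> u (Suc n) \<and> \<lfloor>2 ^ n * r\<rfloor> = \<lfloor>2 ^ n * s\<rfloor>"
proof -
  have "merge_digits G r z i = merge_digits G s u i \<longleftrightarrow>
      z i = u i \<and> binary_digit i r = binary_digit i s" for i
  proof -
    have "inj_on (G i) (Field \<kappa> \<times> digits i)"
      using G by (simp add: digit_coding_def bij_betw_def)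
    then show ?thesis
      unfolding merge_digits_def using u z binary_digit_in_digits
      by (subst inj_on_eq_iff) auto
  qed
  then show ?thesis
    unfolding binary_digits_eq_iff[symmetric] cylinder_def
    using z merge_digits_in_Field[OF G z] by (auto simp: less_Suc_eq_le)
qed

text \<open>The point \<open>x\<close> itself need not be a merged point, as its digits may belong
  to no real; a finite prefix of them always does.\<close>

lemma cylinder_eq_merge_digits:
  assumes G: "digit_coding \<kappa> G" and x: "\<forall>i. x i \<in> Field \<kappa>"
  obtains u s where "\<forall>i. u i \<in> Field \<kappa>"
    and "cylinder \<kappa> x (Suc n) = cylinder \<kappa> (merge_digits G s u) (Suc n)"
proof -
  have "\<exists>c d. c \<in> Field \<kappa> \<and> d \<in> digits i \<and> G i (c, d) = x i" for i
  proof -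
    have "G i ` (Field \<kappa> \<times> digits i) = Field \<kappa>"
      using G by (simp add: digit_coding_def bij_betw_def)
    then have "x i \<in> G i ` (Field \<kappa> \<times> digits i)" using x by simp
    then show ?thesis by force
  qed
  then obtain u d where ud: "\<And>i. u i \<in> Field \<kappa> \<and> d i \<in> digits i \<and> G i (u i, d i) = x i"
    by metis
  then obtain s where "\<forall>i\<le>n. binary_digit i s = d i"
    using exists_binary_digits[of n d] by blast
  then have "\<forall>i<Suc n. merge_digits G s u i = x i"
    using ud by (simp add: merge_digits_def less_Suc_eq_le)
  then have "cylinder \<kappa> x (Suc n) = cylinder \<kappa> (merge_digits G s u) (Suc n)"
    by (auto simp: cylinder_def)
  then show thesis using ud that by blast
qed

lemma nowhere_dense_in_merge_digits_image:
  fixes \<kappa> :: "'k rel"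
  assumes G: "digit_coding \<kappa> G" and N: "nowhere_dense_in euclidean N"
  shows "nowhere_dense_in (omega_power_space \<kappa>)
    {merge_digits G r z |r z. r \<in> N \<and> (\<forall>i. z i \<in> Field \<kappa>)}" (is "nowhere_dense_in _ ?N")
proof (rule nowhere_dense_in_omega_power_spaceI)
  fix x assume "x \<in> ?N"
  then show "\<forall>i. x i \<in> Field \<kappa>" using merge_digits_in_Field[OF G] by blast
next
  fix x :: "nat \<Rightarrow> 'k" and n assume "\<forall>i. x i \<in> Field \<kappa>"
  then obtain u s where u: "\<forall>i. u i \<in> Field \<kappa>"
    and x: "cylinder \<kappa> x (Suc n) = cylinder \<kappa> (merge_digits G s u) (Suc n)"
    by (rule cylinder_eq_merge_digits[OF G])
  obtain k' n' where k': "dyadic_cell k' n' \<subseteq> dyadic_cell \<lfloor>2 ^ n * s\<rfloor> n"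
      "dyadic_cell k' n' \<inter> N = {}"
    using N unfolding nowhere_dense_in_euclideanreal by blast
  \<comment> \<open>Only the real side of the box is narrowed; depth at least \<open>n\<close> keeps
    the longer cylinder inside the given one.\<close>
  obtain k m where m: "n \<le> m" and k: "dyadic_cell k m \<subseteq> dyadic_cell k' n'"
    by (rule dyadic_cell_refine)
  obtain t where t: "t \<in> dyadic_cell k m" using dyadic_cell_nonempty by blast
  let ?y = "merge_digits G t u"
  have "\<lfloor>2 ^ n * t\<rfloor> = \<lfloor>2 ^ n * s\<rfloor>" using t k k'(1) unfolding dyadic_cell_def by blast
  then have "?y \<in> cylinder \<kappa> x (Suc n)"
    unfolding x merge_digits_in_cylinder_iff[OF G u u] using in_cylinder_self[OF u] by simp
  then have "cylinder \<kappa> ?y (Suc m) \<subseteq> cylinder \<kappa> x n"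
    using m by (auto simp: cylinder_def)
  moreover have "cylinder \<kappa> ?y (Suc m) \<inter> ?N = {}"
  proof (rule ccontr)
    assume "\<not> ?thesis"
    then obtain r z where z: "r \<in> N" "\<forall>i. z i \<in> Field \<kappa>"
        "merge_digits G r z \<in> cylinder \<kappa> ?y (Suc m)"
      by blast
    then have "\<lfloor>2 ^ m * r\<rfloor> = \<lfloor>2 ^ m * t\<rfloor>"
      using merge_digits_in_cylinder_iff[OF G u z(2)] by blast
    then have "r \<in> dyadic_cell k m" using t by (simp add: dyadic_cell_def)
    then show False using z(1) k k'(2) by blast
  qed
  moreover have "\<forall>i. ?y i \<in> Field \<kappa>" by (rule merge_digits_in_Field[OF G u])
  ultimately show "\<exists>y m. (\<forall>i. y i \<in> Field \<kappa>) \<and> cylinder \<kappa> y m \<subseteq> cylinder \<kappa> x n \<and>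
      cylinder \<kappa> y m \<inter> ?N = {}"
    by blast
qed

text \<open>The half of the Kuratowski--Ulam theorem that needs only the factor \<open>\<real>\<close> to be second
  countable.\<close>

lemma exists_meager_section:
  fixes \<kappa> :: "'k rel"
  assumes G: "digit_coding \<kappa> G" and "Field \<kappa> \<noteq> {}" and "meager_in (omega_power_space \<kappa>) M"
  shows "\<exists>z. (\<forall>i. z i \<in> Field \<kappa>) \<and> meager_in euclidean {r. merge_digits G r z \<in> M}"
proof -
  let ?X = "omega_power_space \<kappa>"
  obtain N :: "nat \<Rightarrow> _" where N: "\<forall>j. nowhere_dense_in ?X (N j)" and M: "M = (\<Union>j. N j)"
    using assms(3) by (rule meager_in_sequence)
  \<comment> \<open>\<open>B (j, k, n)\<close> collects the \<open>z\<close> for which the section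
    of \<open>N j\<close> meets every cell inside \<open>dyadic_cell k n\<close>. Countability of
    the cells makes these countably many sets.\<close>
  define B where "B = (\<lambda>(j, k, n). {z. (\<forall>i. z i \<in> Field \<kappa>) \<and>
    (\<forall>k' n'. dyadic_cell k' n' \<subseteq> dyadic_cell k n \<longrightarrow>
      (\<exists>r\<in>dyadic_cell k' n'. merge_digits G r z \<in> N j))})"
  have "nowhere_dense_in ?X (B p)" for p
  proof (rule nowhere_dense_in_omega_power_spaceI)
    fix x assume "x \<in> B p"
    then show "\<forall>i. x i \<in> Field \<kappa>" by (auto simp: B_def split: prod.splits)
  next
    obtain j k n where p: "p = (j, k, n)" by (cases p)
    fix u :: "nat \<Rightarrow> 'k" and m assume u: "\<forall>i. u i \<in> Field \<kappa>"
    obtain k' n' where n': "m \<le> n'" and k': "dyadic_cell k' n' \<subseteq> dyadic_cell k n"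
      by (rule dyadic_cell_refine)
    obtain s where s: "s \<in> dyadic_cell k' n'" using dyadic_cell_nonempty by blast
    \<comment> \<open>The box over \<open>u\<close> and the cell is shrunk to a box missing
      \<open>N j\<close>. For each \<open>z\<close> in its cylinder side, the real side is a cell
      inside \<open>dyadic_cell k n\<close> that the section misses, which excludes \<open>z\<close>
      from \<open>B p\<close>.\<close>
    obtain y m' where y: "\<forall>i. y i \<in> Field \<kappa>"
      and ysub: "cylinder \<kappa> y (Suc m') \<subseteq> cylinder \<kappa> (merge_digits G s u) (Suc n')"
      and yN: "cylinder \<kappa> y (Suc m') \<inter> N j = {}"
      by (rule nowhere_dense_in_omega_power_spaceE[OF N[rule_format] merge_digits_in_Field[OF G u]])
    obtain v t where v: "\<forall>i. v i \<in> Field \<kappa>"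
      and yv: "cylinder \<kappa> y (Suc m') = cylinder \<kappa> (merge_digits G t v) (Suc m')"
      using y by (rule cylinder_eq_merge_digits[OF G])
    have in_y: "merge_digits G r z \<in> cylinder \<kappa> y (Suc m')"
      if "z \<in> cylinder \<kappa> v (Suc m')" "r \<in> dyadic_cell \<lfloor>2 ^ m' * t\<rfloor> m'" for r z
    proof -
      have "\<forall>i. z i \<in> Field \<kappa>" using that(1) by (simp add: cylinder_def)
      then show ?thesis
        unfolding yv using that merge_digits_in_cylinder_iff[OF G v]
        by (simp add: dyadic_cell_def)
    qed
    have in_u: "z \<in> cylinder \<kappa> u (Suc n') \<and> r \<in> dyadic_cell k' n'"
      if "z \<in> cylinder \<kappa> v (Suc m')" "r \<in> dyadic_cell \<lfloor>2 ^ m' * t\<rfloor> m'" for r z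
    proof -
      have "\<forall>i. z i \<in> Field \<kappa>" using that(1) by (simp add: cylinder_def)
      moreover have "merge_digits G r z \<in> cylinder \<kappa> (merge_digits G s u) (Suc n')"
        using in_y[OF that] ysub by blast
      ultimately show ?thesis
        using merge_digits_in_cylinder_iff[OF G u] s by (simp add: dyadic_cell_def)
    qed
    have t: "t \<in> dyadic_cell \<lfloor>2 ^ m' * t\<rfloor> m'" by (simp add: dyadic_cell_def)
    have "cylinder \<kappa> v (Suc m') \<subseteq> cylinder \<kappa> u (Suc n')" using in_u t by blast
    then have "cylinder \<kappa> v (Suc m') \<subseteq> cylinder \<kappa> u m"
      using cylinder_mono[of m "Suc n'" \<kappa> u] n' by simp
    moreover have "z \<notin> B p" if z: "z \<in> cylinder \<kappa> v (Suc m')" for z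
    proof -
      have "dyadic_cell \<lfloor>2 ^ m' * t\<rfloor> m' \<subseteq> dyadic_cell k n"
        using in_u[OF z] k' by blast
      moreover have "\<forall>r\<in>dyadic_cell \<lfloor>2 ^ m' * t\<rfloor> m'. merge_digits G r z \<notin> N j"
        using in_y[OF z] yN by blast
      ultimately show ?thesis unfolding B_def p by blast
    qed
    ultimately show "\<exists>y m'. (\<forall>i. y i \<in> Field \<kappa>) \<and> cylinder \<kappa> y m' \<subseteq> cylinder \<kappa> u m \<and>
        cylinder \<kappa> y m' \<inter> B p = {}"
      using v by blast
  qed
  then have "meager_in ?X (\<Union>p. B p)" by (intro meager_in_UN) auto
  moreover obtain c where "c \<in> Field \<kappa>" using assms(2) by blast
  ultimately obtain z where z: "\<forall>i. z i \<in> Field \<kappa>" "z \<notin> (\<Union>p. B p)"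
    using meager_in_omega_power_space_avoid[of \<kappa> _ "\<lambda>_. c"] by metis
  have "nowhere_dense_in euclidean {r. merge_digits G r z \<in> N j}" for j
    unfolding nowhere_dense_in_euclideanreal
  proof (intro allI)
    fix k n
    \<comment> \<open>Lying outside every \<open>B (j, k, n)\<close> is exactly the cell test for
      nowhere density of the sections at \<open>z\<close>.\<close>
    have "z \<notin> B (j, k, n)" using z(2) by blast
    then show "\<exists>k' n'. dyadic_cell k' n' \<subseteq> dyadic_cell k n \<and>
        dyadic_cell k' n' \<inter> {r. merge_digits G r z \<in> N j} = {}"
      using z(1) unfolding B_def by blast
  qed
  then have "meager_in euclidean (\<Union>j. {r. merge_digits G r z \<in> N j})"
    by (intro meager_in_UN) auto
  moreover have "(\<Union>j. {r. merge_digits G r z \<in> N j}) = {r. merge_digits G r z \<in> M}"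
    unfolding M by blast
  ultimately show ?thesis using z(1) by auto
qed

lemma cof_meager_sets_real_le_cof_meager_sets:
  fixes \<kappa> :: "'k rel"
  assumes inf: "infinite (Field \<kappa>)"
  shows "cof (meager_sets (euclidean :: real topology)) \<le>o
    cof (meager_sets (omega_power_space \<kappa>))"
proof -
  let ?X = "omega_power_space \<kappa>"
  obtain G where G: "digit_coding \<kappa> G" using inf by (rule exists_digit_coding)
  have "Field \<kappa> \<noteq> {}" using inf by auto
  then obtain z where z: "\<And>M. meager_in ?X M \<Longrightarrow>
      (\<forall>i. z M i \<in> Field \<kappa>) \<and> meager_in euclidean {r. merge_digits G r (z M) \<in> M}"
    using exists_meager_section[OF G] by metis
  show ?thesis
  proof (rule cof_le_cof[where
        a = "\<lambda>A. {merge_digits G r z |r z. r \<in> A \<and> (\<forall>i. z i \<in> Field \<kappa>)}" and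
        b = "\<lambda>M. {r. merge_digits G r (z M) \<in> M}"])
    fix A :: "real set" assume "A \<in> meager_sets euclidean"
    then have "meager_in euclidean A" by (simp add: meager_sets_def)
    then obtain N :: "nat \<Rightarrow> _"
      where N: "\<forall>j. nowhere_dense_in euclidean (N j)" and A: "A = (\<Union>j. N j)"
      by (rule meager_in_sequence)
    have "meager_in ?X (\<Union>j. {merge_digits G r z |r z. r \<in> N j \<and> (\<forall>i. z i \<in> Field \<kappa>)})"
      using N nowhere_dense_in_merge_digits_image[OF G] by (intro meager_in_UN) auto
    moreover have "(\<Union>j. {merge_digits G r z |r z. r \<in> N j \<and> (\<forall>i. z i \<in> Field \<kappa>)}) =
        {merge_digits G r z |r z. r \<in> A \<and> (\<forall>i. z i \<in> Field \<kappa>)}"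
      unfolding A by blast
    ultimately show "{merge_digits G r z |r z. r \<in> A \<and> (\<forall>i. z i \<in> Field \<kappa>)} \<in> meager_sets ?X"
      by (simp add: meager_sets_def)
  next
    fix M assume "M \<in> meager_sets ?X"
    then show "{r. merge_digits G r (z M) \<in> M} \<in> meager_sets euclidean"
      using z by (simp add: meager_sets_def)
  next
    fix A :: "real set" and M
    assume "M \<in> meager_sets ?X"
      and sub: "{merge_digits G r z |r z. r \<in> A \<and> (\<forall>i. z i \<in> Field \<kappa>)} \<subseteq> M"
    then have "\<forall>i. z M i \<in> Field \<kappa>" using z by (simp add: meager_sets_def)
    then show "A \<subseteq> {r. merge_digits G r (z M) \<in> M}" using sub by blast
  qed
qed

theorem theorem4p4:
  fixes \<kappa> :: "'k rel"
  assumes "Card_order \<kappa>" and "infinite (Field \<kappa>)"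
  shows "cardSuc \<kappa> \<le>o cof (meager_sets (omega_power_space \<kappa>))
    \<and> cf_omega \<kappa> \<le>o cof (meager_sets (omega_power_space \<kappa>))
    \<and> cof (meager_sets (euclidean :: real topology)) \<le>o cof (meager_sets (omega_power_space \<kappa>))
    \<and> cof (meager_sets (omega_power_space \<kappa>)) \<le>o cof (nwd_sets (omega_power_space \<kappa>))
    \<and> cof (nwd_sets (omega_power_space \<kappa>)) \<le>o ctwo ^c \<kappa>"
  using assms cardSuc_le_cof_meager_sets cf_omega_le_cof_meager_sets
    cof_meager_sets_real_le_cof_meager_sets cof_meager_sets_le_cof_nwd_sets cof_nwd_sets_le
  by blast

end
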